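(* Let $H$ denote the substreetution given by $0\mapsto$ (root $0$ with $a$-follower $1$ and $b$-follower $0$) and $1\mapsto$ (root $1$ with $a$-follower $1$ and $b$-follower $0$), equipped with the grammar $BBAB$; that is, $H$ is the map on trees determined by $$H(i[\mathfrak A,\mathfrak B]) = i\big[\,1[H(\mathfrak B),H(\mathfrak B)],\;0[H(\mathfrak A),H(\mathfrak B)]\,\big],\qquad i\in\{0,1\}.$$ Then there exists a unique fixed point $\mathfrak J$ of $H$ with root $0$. The closure $X=\overline{\{T_\omega(\mathfrak J):\omega\in\mathbb F_2^+\}}$ of its orbit is a minimal dynamical system, and it is not periodic (i.e. $\mathfrak J$ is not a periodic tree). There also exists a unique fixed point $\mathfrak J'$ of $H$ with root $1$, and $\mathfrak J'$ coincides with $\mathfrak J$ except at the root.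
   Context: $\mathbb F_2^+$ is the free monoid of finite words over $\{a,b\}$, with identity $e$ (empty word) and length $|\cdot|$. A tree is a map $\mathfrak A:\mathbb F_2^+\to\{0,1\}$, $\omega\mapsto\mathfrak A_\omega$; its root is $\mathfrak A_e$. The distance between two distinct trees is $d(\mathfrak A,\mathfrak B)=2^{-N}$, where $N$ is the minimal length of a word $\omega$ with $\mathfrak A_\omega\ne\mathfrak B_\omega$ (and $d(\mathfrak A,\mathfrak A)=0$). The $\mathbb F_2^+$-action is given by $(T_a\mathfrak A)_x=\mathfrak A_{ax}$, $(T_b\mathfrak A)_x=\mathfrak A_{bx}$, and $T_\omega=T_{\omega_1}\circ\cdots\circ T_{\omega_n}$ for $\omega=\omega_1\ldots\omega_n$ ($T_e$ is the identity). For $i\in\{0,1\}$ and trees $\mathfrak A,\mathfrak B$, $i[\mathfrak A,\mathfrak B]$ denotes the tree $\mathfrak C$ with $\mathfrak C_e=i$, $T_a\mathfrak C=\mathfrak A$, $T_b\mathfrak C=\mathfrak B$. The displayed formula determines $H$ (recursively, generation by generation). A nonempty closed set $X$ of trees with $T_a(X)\cup T_b(X)\subseteq X$ is minimal if it contains no nonempty proper closed subset $Y$ with $T_a(Y)\cup T_b(Y)\subseteq Y$. A tree $\mathfrak A$ is pre-periodic if there is a finite set $\mathcal O$ of trees containing $\mathfrak A$ with $T_a(\mathcal O)\subseteq\mathcal O$ and $T_b(\mathcal O)\subseteq \mathcal O$ ($\mathcal O$ being its orbit); it is periodic if moreover $T_a(\mathcal O)\cup T_b(\mathcal O)=\mathcal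 O$. *)

theory Defs
  imports "HOL-Analysis.Analysis" "HOL-Library.Z2"
begin

datatype letter = la | lb

type_synonym word = "letter list"

text \<open>
  The two root symbols 0 and 1 are the two elements of the type \<^typ>\<open>bit\<close>; its field
  structure plays no role. Maps from words to symbols are wrapped in a type of their own so that
  they can carry the metric below instead of the one that the library puts on functions.
\<close>

datatype tree = Tree (label: "word \<Rightarrow> bit")

abbreviation root_label :: "tree \<Rightarrow> bit" where
  "root_label A \<equiv> label A []"

lemma tree_eq_iff: "A = B \<longleftrightarrow> (\<forall>w. label A w = label B w)"
  by (cases A; cases B) auto

instantiation tree :: metric_space
begin

definition dist_tree :: "tree \<Rightarrow> tree \<Rightarrow> real" where
  "dist_tree A B =
    (if A = B then 0 else 1 / 2 ^ (LEAST n. \<exists>w. length w = n \<and> label A w \<noteq> label B w))"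

definition uniformity_tree :: "(tree \<times> tree) filter" where
  "uniformity_tree = (INF e\<in>{0<..}. principal {(x, y). dist x y < e})"

definition open_tree :: "tree set \<Rightarrow> bool" where
  "open_tree U \<longleftrightarrow> (\<forall>x\<in>U. \<forall>\<^sub>F (x', y) in uniformity. x' = x \<longrightarrow> y \<in> U)"

lemma dist_tree_le:
  assumes "label A w \<noteq> label B w"
  shows "1 / 2 ^ length w \<le> dist A B"
proof -
  let ?N = "LEAST n. \<exists>w. length w = n \<and> label A w \<noteq> label B w"
  have "?N \<le> length w"
    by (rule Least_le) (use assms in blast)
  then have "(2::real) ^ ?N \<le> 2 ^ length w"
    by (intro power_increasing) auto
  then have "1 / (2::real) ^ length w \<le> 1 / 2 ^ ?N"
    by (intro divide_left_mono) auto
  moreover have "A \<noteq> B"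
    using assms by auto
  ultimately show ?thesis
    by (simp add: dist_tree_def)
qed

lemma dist_tree_attained:
  assumes "A \<noteq> B"
  obtains w where "label A w \<noteq> label B w" "dist A B = 1 / 2 ^ length w"
proof -
  let ?P = "\<lambda>n. \<exists>w. length w = n \<and> label A w \<noteq> label B w"
  obtain w where "label A w \<noteq> label B w"
    using assms tree_eq_iff by blast
  then have "?P (length w)"
    by blast
  then have "?P (Least ?P)"
    by (rule LeastI)
  then show ?thesis
    using that assms by (auto simp: dist_tree_def)
qed

instance
proof
  fix A B C :: tree
  show "dist A B = 0 \<longleftrightarrow> A = B"
    by (simp add: dist_tree_def)
  show "dist A B \<le> dist A C + dist B C"
  proof (cases "A = B")
    case True
    then show ?thesis
      by (simp add: dist_tree_def)
  next
    case False
    then obtain w where w: "label A w \<noteq> label B w" "dist A B = 1 / 2 ^ length w"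
      by (rule dist_tree_attained)
    have nn: "0 \<le> dist A C" "0 \<le> dist B C"
      by (simp_all add: dist_tree_def)
    from w(1) have "label A w \<noteq> label C w \<or> label B w \<noteq> label C w"
      by auto
    then show ?thesis
      using dist_tree_le[of A w C] dist_tree_le[of B w C] w(2) nn by linarith
  qed
qed (simp_all add: uniformity_tree_def open_tree_def)

end

definition T :: "letter \<Rightarrow> tree \<Rightarrow> tree" where
  "T c A = Tree (\<lambda>x. label A (c # x))"

definition T_word :: "word \<Rightarrow> tree \<Rightarrow> tree" where
  "T_word w A = foldr T w A"

definition node :: "bit \<Rightarrow> tree \<Rightarrow> tree \<Rightarrow> tree" where
  "node i A B = Tree (\<lambda>w. case w of [] \<Rightarrow> i | la # x \<Rightarrow> label A x | lb # x \<Rightarrow> label B x)"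

lemma root_label_node [simp]: "root_label (node i A B) = i"
  and T_node [simp]: "T la (node i A B) = A" "T lb (node i A B) = B"
  by (simp_all add: node_def T_def)

lemma node_eta: "node (root_label A) (T la A) (T lb A) = A"
  by (auto simp: tree_eq_iff node_def T_def split: list.split letter.split)

definition orbit :: "tree \<Rightarrow> tree set" where
  "orbit A = {T_word w A | w. True}"

definition invariant :: "tree set \<Rightarrow> bool" where
  "invariant X \<longleftrightarrow> T la ` X \<union> T lb ` X \<subseteq> X"

definition minimal :: "tree set \<Rightarrow> bool" where
  "minimal X \<longleftrightarrow> X \<noteq> {} \<and> closed X \<and> invariant X \<and>
    \<not> (\<exists>Y. Y \<noteq> {} \<and> Y \<subset> X \<and> closed Y \<and> invariant Y)"

definition pre_periodic :: "tree \<Rightarrow> bool" where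
  "pre_periodic A \<longleftrightarrow> (\<exists>S. finite S \<and> A \<in> S \<and> T la ` S \<subseteq> S \<and> T lb ` S \<subseteq> S)"

text \<open>
  In the definition of periodicity the finite invariant set is the orbit itself: every finite
  invariant set can be enlarged to a finite invariant set on which the two maps are jointly
  surjective, so leaving it arbitrary would make every pre-periodic tree periodic.
\<close>

definition periodic :: "tree \<Rightarrow> bool" where
  "periodic A \<longleftrightarrow> pre_periodic A \<and> T la ` orbit A \<union> T lb ` orbit A = orbit A"

lemma orbit_least:
  assumes "A \<in> S" "T la ` S \<subseteq> S" "T lb ` S \<subseteq> S"
  shows "orbit A \<subseteq> S"
proof -
  have "T c B \<in> S" if "B \<in> S" for c B
    using that assms(2,3) by (cases c) auto
  then have "T_word w A \<in> S" for w
    using assms(1) by (induction w) (auto simp: T_word_def)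
  then show ?thesis
    by (auto simp: orbit_def)
qed

lemma invariant_orbit: "invariant (orbit A)"
proof -
  have "T c (T_word w A) \<in> orbit A" for c w
    unfolding orbit_def by (auto simp: T_word_def intro: exI[of _ "c # w"])
  then show ?thesis
    by (auto simp: invariant_def orbit_def)
qed

lemma mem_orbit: "A \<in> orbit A"
  by (auto simp: orbit_def T_word_def intro: exI[of _ "[]"])

lemma pre_periodic_iff: "pre_periodic A \<longleftrightarrow> finite (orbit A)"
  using orbit_least[of A] invariant_orbit[of A] mem_orbit[of A] finite_subset
  unfolding pre_periodic_def invariant_def by (metis Un_subset_iff)

fun H_label :: "tree \<Rightarrow> word \<Rightarrow> bit" where
  "H_label A [] = root_label A"
| "H_label A [la] = 1"
| "H_label A [lb] = 0"
| "H_label A (la # la # w) = H_label (T lb A) w"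
| "H_label A (la # lb # w) = H_label (T lb A) w"
| "H_label A (lb # la # w) = H_label (T la A) w"
| "H_label A (lb # lb # w) = H_label (T lb A) w"

definition H :: "tree \<Rightarrow> tree" where
  "H A = Tree (H_label A)"

text \<open>The map \<^const>\<open>H\<close> is the only one that satisfies the recursive equation of the substreetution:\<close>

lemma H_node: "H (node i A B) = node i (node 1 (H B) (H B)) (node 0 (H A) (H B))"
  by (auto simp: tree_eq_iff H_def node_def T_def split: list.split letter.split)

lemma H_unique:
  assumes "\<And>i A B. F (node i A B) = node i (node 1 (F B) (F B)) (node 0 (F A) (F B))"
  shows "F = H"
proof
  fix A
  have eq: "F A = node (root_label A) (node 1 (F (T lb A)) (F (T lb A))) (node 0 (F (T la A)) (F (T lb A)))"
    for A
    using assms[of "root_label A" "T la A" "T lb A"] by (simp add: node_eta)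
  have "label (F A) w = H_label A w" for w
    by (induction A w rule: H_label.induct) (subst eq, simp add: node_def)+
  then show "F A = H A"
    by (simp add: tree_eq_iff H_def)
qed

end

theory Submission imports Defs begin

text \<open>
  Reading a word two letters at a time turns the substreetution into a map on positions: the grammar
  replaces the blocks \<open>aa\<close>, \<open>ab\<close>, \<open>bb\<close> by \<open>b\<close> and the block \<open>ba\<close> by \<open>a\<close> (the function \<open>desub\<close>
  below). In \<open>H A\<close>, a position of even length carries the label that \<open>A\<close> has at the
  desubstituted position, and a position of odd length carries a label that depends on its last
  letter only (lemma \<open>label_H\<close>). Desubstitution halves lengths, is onto, and commutes with
  appending to a word of even length. The theorem follows from this description.

  \<^item> The label of a fixed point at a nonempty word is found by desubstituting until the length is
    odd. This happens before the empty word is reached, so the root has no influence on the other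
    labels and can be chosen freely. The same recursion defines the two fixed points.

  \<^item> Minimality is uniform recurrence: every position of a fixed point \<open>J\<close> has, at bounded
    distance below it, a position where \<open>J\<close> looks like it does at the root up to a given depth.
    For depth one this holds because the odd levels show both labels. The depth is doubled by
    desubstituting, applying the statement there, and lifting back (lemma
    \<open>fixed_point_uniformly_recurrent\<close>).

  \<^item> The orbit of \<open>J\<close> is infinite, so \<open>J\<close> is not even pre-periodic: \<open>H\<close> maps the orbit injectively
    into itself, but misses the orbit element \<open>T la J\<close>: its \<open>a\<close>-follower is labelled \<open>0\<close>, whereas
    the \<open>a\<close>-follower of every tree \<open>H A\<close> is labelled \<open>1\<close>.
\<close>

section \<open>Desubstitution of positions\<close>

text \<open>A last letter that is not part of a block is dropped, which keeps the length at the integer half.\<close>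

fun desub :: "word \<Rightarrow> word" where
  "desub (la # c # w) = lb # desub w"
| "desub (lb # c # w) = c # desub w"
| "desub w = []"

fun follower_label :: "letter \<Rightarrow> bit" where
  "follower_label la = 1"
| "follower_label lb = 0"

lemma length_desub [simp]: "length (desub w) = length w div 2"
  by (induction w rule: desub.induct) auto

lemma desub_append: "even (length u) \<Longrightarrow> desub (u @ x) = desub u @ desub x"
  by (induction u rule: desub.induct) auto

text \<open>The letter \<open>a\<close> has only the block \<open>ba\<close> above it; for \<open>b\<close> any of the three other blocks would do.\<close>

lemma desub_surj: obtains u where "desub u = v" "length u = 2 * length v"
proof -
  have "\<exists>u. desub u = v \<and> length u = 2 * length v"
  proof (induction v)
    case Nil
    show ?case by (intro exI[of _ "[]"]) simp
  next
    case (Cons c v)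
    then obtain u where "desub u = v" "length u = 2 * length v" by blast
    then show ?case by (intro exI[of _ "lb # c # u"]) simp
  qed
  then show ?thesis using that by blast
qed

lemma label_H: "label (H A) w =
  (if even (length w) then label A (desub w) else follower_label (last w))"
proof -
  have "H_label A w = (if even (length w) then label A (desub w) else follower_label (last w))"
    by (induction A w rule: H_label.induct) (auto simp: T_def)
  then show ?thesis by (simp add: H_def)
qed

lemma fixed_point_label:
  assumes "H J = J"
  shows "label J w = (if even (length w) then label J (desub w) else follower_label (last w))"
  using label_H[of J w] assms by simp

section \<open>Fixed points with a given root\<close>

function fixed_label :: "bit \<Rightarrow> word \<Rightarrow> bit" where
  "fixed_label i w = (if w = [] then i else if even (length w) then fixed_label i (desub w)
    else follower_label (last w))"
  by auto
termination by (relation "Wellfounded.measure (\<lambda>(i, w). length w)") auto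

declare fixed_label.simps [simp del]

lemma fixed_point_exists: "\<exists>J. H J = J \<and> root_label J = i"
proof (intro exI conjI)
  let ?J = "Tree (fixed_label i)"
  have "label (H ?J) w = fixed_label i w" for w
    by (cases "w = []") (auto simp: label_H fixed_label.simps[of i w])
  then show "H ?J = ?J" by (simp add: tree_eq_iff)
  show "root_label ?J = i" by (simp add: fixed_label.simps)
qed

text \<open>
  Halving a positive even length gives a positive length, so repeated desubstitution of a nonempty
  word ends at a word of odd length, whose label is the same for all fixed points.
\<close>

lemma fixed_points_agree_below_root:
  assumes "H J = J" "H J' = J'" "w \<noteq> []"
  shows "label J' w = label J w"
  using assms(3)
proof (induction w rule: length_induct)
  case (1 w)
  show ?case
  proof (cases "even (length w)")
    case True
    then have "length w \<ge> 2" using 1(2) by (cases w rule: desub.cases) auto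
    then have "length (desub w) < length w" "length (desub w) > 0" by auto
    then have "label J' (desub w) = label J (desub w)"
      using 1(1) by (metis length_greater_0_conv)
    with True show ?thesis
      using fixed_point_label[OF assms(1), of w] fixed_point_label[OF assms(2), of w] by simp
  next
    case False
    then show ?thesis
      using fixed_point_label[OF assms(1), of w] fixed_point_label[OF assms(2), of w] by simp
  qed
qed

lemma fixed_point_unique: "\<exists>!J. H J = J \<and> root_label J = i"
proof (rule ex_ex1I)
  show "\<exists>J. H J = J \<and> root_label J = i" by (rule fixed_point_exists)
  fix J J' assume "H J = J \<and> root_label J = i" "H J' = J' \<and> root_label J' = i"
  then show "J = J'"
    using fixed_points_agree_below_root[of J' J] unfolding tree_eq_iff by metis
qed

section \<open>Orbits and closures in terms of labels\<close>

lemma label_T [simp]: "label (T c A) x = label A (c # x)"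
  by (simp add: T_def)

text \<open>\<^const>\<open>T_word\<close> applies its last letter first, so positions come out reversed.\<close>

lemma label_T_word: "label (T_word w A) x = label A (rev w @ x)"
  by (induction w arbitrary: x) (auto simp: T_word_def)

lemma mem_orbit_iff: "B \<in> orbit A \<longleftrightarrow> (\<exists>w. \<forall>x. label B x = label A (w @ x))"
proof
  assume "B \<in> orbit A"
  then show "\<exists>w. \<forall>x. label B x = label A (w @ x)"
    by (auto simp: orbit_def label_T_word)
next
  assume "\<exists>w. \<forall>x. label B x = label A (w @ x)"
  then obtain w where "\<forall>x. label B x = label A (w @ x)" by blast
  then have "B = T_word (rev w) A" by (simp add: tree_eq_iff label_T_word)
  then show "B \<in> orbit A" by (auto simp: orbit_def)
qed

lemma T_word_mem_invariant:
  assumes "invariant Y" "B \<in> Y"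
  shows "T_word u B \<in> Y"
  using orbit_least[of B Y] assms by (auto simp: invariant_def orbit_def)

text \<open>Balls of radius \<open>1 / 2 ^ n\<close> are the classes of trees with the same first generations.\<close>

lemma closure_iff_agree:
  "A \<in> closure S \<longleftrightarrow> (\<forall>n. \<exists>B\<in>S. \<forall>w. length w < n \<longrightarrow> label B w = label A w)"
proof
  assume A: "A \<in> closure S"
  show "\<forall>n. \<exists>B\<in>S. \<forall>w. length w < n \<longrightarrow> label B w = label A w"
  proof
    fix n
    have "(0::real) < 1 / 2 ^ n" by simp
    then obtain B where B: "B \<in> S" "dist B A < 1 / 2 ^ n"
      using A unfolding closure_approachable by blast
    have "label B w = label A w" if "length w < n" for w
    proof (rule ccontr)
      assume "label B w \<noteq> label A w"
      then have "1 / 2 ^ length w \<le> dist B A" by (rule dist_tree_le)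
      moreover have "(1::real) / 2 ^ n \<le> 1 / 2 ^ length w"
        using that by (intro divide_left_mono power_increasing) auto
      ultimately show False using B(2) by linarith
    qed
    then show "\<exists>B\<in>S. \<forall>w. length w < n \<longrightarrow> label B w = label A w" using B(1) by blast
  qed
next
  assume agree: "\<forall>n. \<exists>B\<in>S. \<forall>w. length w < n \<longrightarrow> label B w = label A w"
  show "A \<in> closure S"
    unfolding closure_approachable
  proof (intro allI impI)
    fix e :: real assume e: "e > 0"
    obtain n where n: "(1 / 2) ^ n < e"
      using real_arch_pow_inv[OF e, of "1/2"] by auto
    obtain B where B: "B \<in> S" "\<forall>w. length w < n \<longrightarrow> label B w = label A w"
      using agree by blast
    have "dist B A < e"
    proof (cases "B = A")
      case True
      then show ?thesis using e by simp
    next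
      case False
      then obtain w where w: "label B w \<noteq> label A w" "dist B A = 1 / 2 ^ length w"
        by (rule dist_tree_attained)
      then have "n \<le> length w" using B(2) not_less by blast
      then have "(1::real) / 2 ^ length w \<le> 1 / 2 ^ n"
        by (intro divide_left_mono power_increasing) auto
      then show ?thesis using w(2) n by (simp add: power_one_over)
    qed
    then show "\<exists>B\<in>S. dist B A < e" using B(1) by blast
  qed
qed

lemma invariant_closure:
  assumes "invariant S"
  shows "invariant (closure S)"
proof -
  have "T c A \<in> closure S" if A: "A \<in> closure S" for c A
    unfolding closure_iff_agree
  proof
    fix n
    obtain B where B: "B \<in> S" "\<forall>w. length w < Suc n \<longrightarrow> label B w = label A w"
      using A unfolding closure_iff_agree by blast
    have "T c B \<in> S" using B(1) assms by (cases c) (auto simp: invariant_def)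
    then show "\<exists>B\<in>S. \<forall>w. length w < n \<longrightarrow> label B w = label (T c A) w"
      using B(2) by (intro bexI[of _ "T c B"]) auto
  qed
  then show ?thesis by (auto simp: invariant_def)
qed

text \<open>
  The bound \<open>M\<close> must not depend on \<open>w\<close>: a limit point of the orbit resembles some
  subtree only down to a finite depth, which has to be chosen before the return word is known.
\<close>

lemma minimal_closure_orbit:
  assumes recurrent: "\<And>n. \<exists>M. \<forall>w. \<exists>u. length u \<le> M \<and>
    (\<forall>x. length x < n \<longrightarrow> label J (w @ u @ x) = label J x)"
  shows "minimal (closure (orbit J))"
  unfolding minimal_def
proof (intro conjI notI)
  show False if "closure (orbit J) = {}" using that mem_orbit[of J] closure_subset by blast
  show "closed (closure (orbit J))" by simp
  show "invariant (closure (orbit J))" by (intro invariant_closure invariant_orbit)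
  assume "\<exists>Y. Y \<noteq> {} \<and> Y \<subset> closure (orbit J) \<and> closed Y \<and> invariant Y"
  then obtain Y where Y: "Y \<noteq> {}" "Y \<subset> closure (orbit J)" "closed Y" "invariant Y" by blast
  then obtain B where B: "B \<in> Y" "B \<in> closure (orbit J)" by blast
  have "J \<in> closure Y"
    unfolding closure_iff_agree
  proof
    fix n
    obtain M where M: "\<forall>w. \<exists>u. length u \<le> M \<and>
        (\<forall>x. length x < n \<longrightarrow> label J (w @ u @ x) = label J x)"
      using recurrent by blast
    obtain C where C: "C \<in> orbit J" "\<forall>w. length w < M + n \<longrightarrow> label C w = label B w"
      using B(2) unfolding closure_iff_agree by blast
    obtain w where w: "\<forall>x. label C x = label J (w @ x)"
      using C(1) unfolding mem_orbit_iff by blast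
    obtain u where u: "length u \<le> M" "\<forall>x. length x < n \<longrightarrow> label J (w @ u @ x) = label J x"
      using M by blast
    have "label (T_word (rev u) B) x = label J x" if "length x < n" for x
    proof -
      have "label (T_word (rev u) B) x = label C (u @ x)"
        using C(2) u(1) that by (simp add: label_T_word)
      then show ?thesis using w u(2) that by simp
    qed
    then show "\<exists>B\<in>Y. \<forall>w. length w < n \<longrightarrow> label B w = label J w"
      using T_word_mem_invariant[OF Y(4) B(1)] by blast
  qed
  then have "J \<in> Y" using Y(3) by simp
  then have "orbit J \<subseteq> Y" using orbit_least[of J Y] Y(4) by (simp add: invariant_def)
  then have "closure (orbit J) \<subseteq> Y" using Y(3) by (rule closure_minimal)
  then show False using Y(2) by blast
qed

section \<open>Uniform recurrence of fixed points\<close>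

lemma fixed_point_uniformly_recurrent:
  assumes fixed: "H J = J"
  shows "\<exists>M. \<forall>w. \<exists>u. length u \<le> M \<and>
    (\<forall>x. length x < 2 ^ k \<longrightarrow> label J (w @ u @ x) = label J x)"
proof (induction k)
  case 0
  obtain c where c: "follower_label c = root_label J"
    by (cases "root_label J") (metis follower_label.simps)+
  have "\<exists>u. length u \<le> 2 \<and> label J (w @ u) = root_label J" for w
  proof (cases "even (length w)")
    case True
    then show ?thesis
      using c fixed_point_label[OF fixed, of "w @ [c]"] by (intro exI[of _ "[c]"]) simp
  next
    case False
    then show ?thesis
      using c fixed_point_label[OF fixed, of "w @ [c, c]"] by (intro exI[of _ "[c, c]"]) simp
  qed
  then show ?case by (intro exI[of _ 2]) simp
next
  case (Suc k)
  then obtain M where M: "\<And>w. \<exists>u. length u \<le> M \<and>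
      (\<forall>x. length x < 2 ^ k \<longrightarrow> label J (w @ u @ x) = label J x)"
    by blast
  have "\<exists>u. length u \<le> 1 + 2 * M \<and>
      (\<forall>x. length x < 2 ^ Suc k \<longrightarrow> label J (w @ u @ x) = label J x)" for w
  proof -
    \<comment> \<open>Pad to even length, so that the position below it can be desubstituted.\<close>
    define r where "r = (if even (length w) then [] else [la])"
    have r: "length r \<le> 1" "even (length (w @ r))" by (auto simp: r_def)
    obtain v where v: "length v \<le> M"
        "\<forall>x. length x < 2 ^ k \<longrightarrow> label J (desub (w @ r) @ v @ x) = label J x"
      using M by blast
    obtain s where s: "desub s = v" "length s = 2 * length v" by (rule desub_surj)
    have parity: "even (length (w @ r @ s @ x)) \<longleftrightarrow> even (length x)" for x
      using r(2) s(2) by auto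
    have desub: "desub (w @ r @ s @ x) = desub (w @ r) @ v @ desub x" for x
      using r(2) s by (simp add: desub_append flip: append_assoc)
    have "label J (w @ r @ s @ x) = label J x" if x: "length x < 2 ^ Suc k" for x
    proof (cases "even (length x)")
      case True
      then have "label J (w @ r @ s @ x) = label J (desub (w @ r) @ v @ desub x)"
        using fixed_point_label[OF fixed, of "w @ r @ s @ x"] parity[of x] desub[of x] by presburger
      also have "\<dots> = label J (desub x)" using v(2) x by simp
      also have "\<dots> = label J x" using fixed_point_label[OF fixed, of x] True by simp
      finally show ?thesis .
    next
      case False
      then have "x \<noteq> []" by auto
      then have "last (w @ r @ s @ x) = last x" by simp
      with False show ?thesis
        using fixed_point_label[OF fixed, of "w @ r @ s @ x"] fixed_point_label[OF fixed, of x]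
          parity[of x]
        by presburger
    qed
    then show ?thesis using r(1) s(2) v(1) by (intro exI[of _ "r @ s"]) auto
  qed
  then show ?case by blast
qed

lemma fixed_point_minimal:
  assumes "H J = J"
  shows "minimal (closure (orbit J))"
proof (rule minimal_closure_orbit)
  fix n :: nat
  have "n < 2 ^ n" by simp
  then show "\<exists>M. \<forall>w. \<exists>u. length u \<le> M \<and>
      (\<forall>x. length x < n \<longrightarrow> label J (w @ u @ x) = label J x)"
    using fixed_point_uniformly_recurrent[OF assms, of n] by (meson less_trans)
qed

section \<open>Infinite orbits of fixed points\<close>

lemma inj_H: "inj H"
proof (rule injI)
  fix A B assume eq: "H A = H B"
  have "label A v = label B v" for v
  proof -
    obtain u where "desub u = v" "length u = 2 * length v" by (rule desub_surj)
    then show ?thesis using label_H[of A u] label_H[of B u] eq by simp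
  qed
  then show "A = B" by (simp add: tree_eq_iff)
qed

lemma H_mem_orbit:
  assumes fixed: "H J = J" and "A \<in> orbit J"
  shows "H A \<in> orbit J"
proof -
  obtain v where v: "\<And>x. label A x = label J (v @ x)" using assms(2) mem_orbit_iff by blast
  obtain u where u: "desub u = v" "length u = 2 * length v" by (rule desub_surj)
  have "label (H A) x = label J (u @ x)" for x
    using fixed_point_label[OF fixed, of "u @ x"] u v
    by (cases "x = []") (auto simp: label_H desub_append)
  then show ?thesis unfolding mem_orbit_iff by blast
qed

lemma infinite_orbit_fixed_point:
  assumes fixed: "H J = J"
  shows "infinite (orbit J)"
proof
  assume fin: "finite (orbit J)"
  have "H ` orbit J = orbit J"
    using H_mem_orbit[OF fixed] inj_H by (intro endo_inj_surj[OF fin]) (auto intro: inj_on_subset)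
  moreover have "T la J \<in> orbit J"
    using invariant_orbit[of J] mem_orbit[of J] by (auto simp: invariant_def)
  ultimately obtain A where A: "T la J = H A" by blast
  \<comment> \<open>The word \<open>aa\<close> desubstitutes to \<open>b\<close>, which is labelled \<open>0\<close>.\<close>
  have "label (T la J) [la] = 0"
    using fixed_point_label[OF fixed, of "[la, la]"] fixed_point_label[OF fixed, of "[lb]"] by simp
  moreover have "label (H A) [la] = 1" by (simp add: label_H)
  ultimately show False using A by simp
qed

theorem theorem1:
  shows "(\<exists>!J. H J = J \<and> root_label J = 0) \<and>
    (\<forall>J. H J = J \<and> root_label J = 0 \<longrightarrow> minimal (closure (orbit J)) \<and> \<not> periodic J) \<and>
    (\<exists>!J'. H J' = J' \<and> root_label J' = 1) \<and>
    (\<forall>J J'. H J = J \<and> root_label J = 0 \<and> H J' = J' \<and> root_label J' = 1 \<longrightarrow>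
      (\<forall>w. w \<noteq> [] \<longrightarrow> label J' w = label J w))"
proof (intro conjI allI impI)
  show "\<exists>!J. H J = J \<and> root_label J = 0" "\<exists>!J'. H J' = J' \<and> root_label J' = 1"
    by (rule fixed_point_unique)+
next
  fix J assume J: "H J = J \<and> root_label J = 0"
  then show "minimal (closure (orbit J))" by (simp add: fixed_point_minimal)
  show "\<not> periodic J"
    using J infinite_orbit_fixed_point by (auto simp: periodic_def pre_periodic_iff)
next
  fix J J' and w :: word
  assume "H J = J \<and> root_label J = 0 \<and> H J' = J' \<and> root_label J' = 1" "w \<noteq> []"
  then show "label J' w = label J w" by (intro fixed_points_agree_below_root) auto
qed

end
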